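(* Let $\mathcal L\in\{\mathbf{nbIciw},\mathbf{nbIci},\mathbf{nbIcl}\}$. For every set of formulas $\Gamma\cup\{\varphi\}\subseteq \mathbf{F}(\Sigma_{\mathbf{nbI}},\mathcal V)$: if $\Gamma\Vdash^{\mathcal L}_{\mathcal F}\varphi$ then $\Gamma\vdash_{\mathcal L}\varphi$.
   Context: Let $\mathcal V$ be a countable set of propositional variables and $\Sigma_{\mathbf{nbI}}=\{\vee,\wedge,\rightarrow,\uparrow,\neg\}$ with $\neg$ unary and the other connectives binary; $\mathbf F(\Sigma_{\mathbf{nbI}},\mathcal V)$ is the set of formulas. The logic $\mathbf{nbI}$ is the Hilbert calculus whose only inference rule is Modus Ponens and whose axioms are all instances (with arbitrary formulas) of: (1) $\alpha\to(\beta\to\alpha)$; (2) $(\alpha\to(\beta\to\gamma))\to((\alpha\to\beta)\to(\alpha\to\gamma))$; (3) $\alpha\to(\beta\to(\alpha\wedge\beta))$; (4) $(\alpha\wedge\beta)\to\alpha$; (5) $(\alpha\wedge\beta)\to\beta$; (6) $\alpha\to(\alpha\vee\beta)$; (7) $\beta\to(\alpha\vee\beta)$; (8) $(\alpha\to\gamma)\to((\beta\to\gamma)\to((\alpha\vee\beta)\to\gamma))$; (9) $(\alpha\to\beta)\vee\alpha$; (Ip) $(\alpha\uparrow\beta)\to(\alpha\to(\beta\to\gamma))$; (Comm) $(\alpha\uparrow\beta)\to(\beta\uparrow\alpha)$; (11) $\alpha\vee\neg\alpha$. The logics $\mathbf{nbIciw}$, $\mathbf{nbIci}$, $\mathbf{nbIcl}$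 are obtained from $\mathbf{nbI}$ by adding, respectively, all instances of $(\alpha\uparrow\neg\alpha)\vee(\alpha\wedge\neg\alpha)$; of $\neg(\alpha\uparrow\neg\alpha)\to(\alpha\wedge\neg\alpha)$; of $\neg(\alpha\wedge\neg\alpha)\to(\alpha\uparrow\neg\alpha)$. $\Gamma\vdash_{\mathcal L}\varphi$ means that there is a finite derivation of $\varphi$ from premises in $\Gamma$ in the calculus of $\mathcal L$. A $\Sigma$-multialgebra on a nonempty set $A$ interprets each $n$-ary connective $\sigma$ as a function $\sigma_{\mathcal A}:A^n\to\wp(A)\setminus\{\emptyset\}$; an operation with only singleton values is identified with an ordinary operation; a multioperation applied to a set means the union of its values on the elements of the set. A valuation over $\mathcal A$ is a map $\nu$ from formulas to $A$ with $\nu(\sigma(\varphi_1,\dots,\varphi_n))\in\sigma_{\mathcal A}(\nu(\varphi_1),\dots,\nu(\varphi_n))$ for all connectives $\sigma$ and formulas $\varphi_i$. An RNmatrix (restricted non-deterministic matrix) for $\mathcal L$ is a triple $(\mathcal A,D,\mathcal F)$ where: - $\mathcal A$ is a $\Sigma_{\mathbf{nbI}}$-multialgebra with universe $A$ in which $\wedge,\vee,\to$ are ordinary operations making $A$ a Boolean algebra with bottom $0$, top $1$ (with $\to$ the Boolean implication) and Boolean complement ${\sim}a=a\to0$, and such that for all $a,b,c\in A$: $a\uparrow b=b\uparrow a$ (as sets); if $c\in a\uparrow b$ then $a\wedge b\wedge c=0$; if $b\in\neg a$ then $a\vee b=1$; if $b\in\neg a$ then ${\sim}(a\wedge b)\in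 a\uparrow b$; if $\mathcal L=\mathbf{nbIci}$: $b\in\neg a$ implies $a\wedge b\in\neg(a\uparrow b)$; if $\mathcal L=\mathbf{nbIcl}$: $b\in\neg a$ implies ${\sim}(a\wedge b)\in\neg(a\wedge b)$; - $D=\{1\}$ (designated elements; $D$ is a proper subset of $A$, i.e. $0\ne1$); - $\mathcal F$ is the set of all valuations $\nu$ over $\mathcal A$ such that for all formulas $\alpha,\beta$: $\nu(\alpha\uparrow\beta)=\nu(\beta\uparrow\alpha)$; $\nu(\alpha\uparrow\neg\alpha)={\sim}(\nu(\alpha)\wedge\nu(\neg\alpha))$; if $\mathcal L=\mathbf{nbIci}$: $\nu(\neg(\alpha\uparrow\neg\alpha))=\nu(\alpha)\wedge\nu(\neg\alpha)$; if $\mathcal L=\mathbf{nbIcl}$: $\nu(\alpha\uparrow\neg\alpha)=\nu(\neg(\alpha\wedge\neg\alpha))$. $\Gamma\Vdash^{\mathcal L}_{\mathcal F}\varphi$ means: for every RNmatrix $(\mathcal A,D,\mathcal F)$ for $\mathcal L$ and every $\nu\in\mathcal F$, if $\nu(\gamma)\in D$ for all $\gamma\in\Gamma$ then $\nu(\varphi)\in D$. *)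

theory Defs
  imports "HOL-Library.Countable" "HOL-Library.Infinite_Typeclass"
begin

section \<open>Formulas and Hilbert calculi\<close>

datatype 'v fm =
    Var 'v
  | Or "'v fm" "'v fm"  (infixr "\<^bold>\<or>" 55)
  | And "'v fm" "'v fm"  (infixr "\<^bold>\<and>" 60)
  | Imp "'v fm" "'v fm"  (infixr "\<^bold>\<rightarrow>" 50)
  | Inc "'v fm" "'v fm"  (infix "\<^bold>\<up>" 65)
  | Neg "'v fm"  ("\<^bold>\<not> _" [80] 80)

datatype logic = nbIciw | nbIci | nbIcl

inductive axiom_nbI :: "'v fm \<Rightarrow> bool" where
  "axiom_nbI (\<alpha> \<^bold>\<rightarrow> (\<beta> \<^bold>\<rightarrow> \<alpha>))"
| "axiom_nbI ((\<alpha> \<^bold>\<rightarrow> (\<beta> \<^bold>\<rightarrow> \<gamma>)) \<^bold>\<rightarrow> ((\<alpha> \<^bold>\<rightarrow> \<beta>) \<^bold>\<rightarrow> (\<alpha> \<^bold>\<rightarrow> \<gamma>)))"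
| "axiom_nbI (\<alpha> \<^bold>\<rightarrow> (\<beta> \<^bold>\<rightarrow> (\<alpha> \<^bold>\<and> \<beta>)))"
| "axiom_nbI ((\<alpha> \<^bold>\<and> \<beta>) \<^bold>\<rightarrow> \<alpha>)"
| "axiom_nbI ((\<alpha> \<^bold>\<and> \<beta>) \<^bold>\<rightarrow> \<beta>)"
| "axiom_nbI (\<alpha> \<^bold>\<rightarrow> (\<alpha> \<^bold>\<or> \<beta>))"
| "axiom_nbI (\<beta> \<^bold>\<rightarrow> (\<alpha> \<^bold>\<or> \<beta>))"
| "axiom_nbI ((\<alpha> \<^bold>\<rightarrow> \<gamma>) \<^bold>\<rightarrow> ((\<beta> \<^bold>\<rightarrow> \<gamma>) \<^bold>\<rightarrow> ((\<alpha> \<^bold>\<or> \<beta>) \<^bold>\<rightarrow> \<gamma>)))"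
| "axiom_nbI ((\<alpha> \<^bold>\<rightarrow> \<beta>) \<^bold>\<or> \<alpha>)"
| Ip: "axiom_nbI ((\<alpha> \<^bold>\<up> \<beta>) \<^bold>\<rightarrow> (\<alpha> \<^bold>\<rightarrow> (\<beta> \<^bold>\<rightarrow> \<gamma>)))"
| Comm: "axiom_nbI ((\<alpha> \<^bold>\<up> \<beta>) \<^bold>\<rightarrow> (\<beta> \<^bold>\<up> \<alpha>))"
| "axiom_nbI (\<alpha> \<^bold>\<or> \<^bold>\<not> \<alpha>)"

fun extra_axiom :: "logic \<Rightarrow> 'v fm \<Rightarrow> 'v fm" where
  "extra_axiom nbIciw \<alpha> = ((\<alpha> \<^bold>\<up> \<^bold>\<not> \<alpha>) \<^bold>\<or> (\<alpha> \<^bold>\<and> \<^bold>\<not> \<alpha>))"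
| "extra_axiom nbIci \<alpha> = (\<^bold>\<not> (\<alpha> \<^bold>\<up> \<^bold>\<not> \<alpha>) \<^bold>\<rightarrow> (\<alpha> \<^bold>\<and> \<^bold>\<not> \<alpha>))"
| "extra_axiom nbIcl \<alpha> = (\<^bold>\<not> (\<alpha> \<^bold>\<and> \<^bold>\<not> \<alpha>) \<^bold>\<rightarrow> (\<alpha> \<^bold>\<up> \<^bold>\<not> \<alpha>))"

definition is_axiom :: "logic \<Rightarrow> 'v fm \<Rightarrow> bool" where
  "is_axiom L \<phi> \<longleftrightarrow> axiom_nbI \<phi> \<or> (\<exists>\<alpha>. \<phi> = extra_axiom L \<alpha>)"

definition derivation :: "logic \<Rightarrow> 'v fm set \<Rightarrow> 'v fm list \<Rightarrow> bool" where
  "derivation L \<Gamma> ds \<longleftrightarrow>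
     (\<forall>i<length ds. is_axiom L (ds ! i) \<or> ds ! i \<in> \<Gamma> \<or>
        (\<exists>j<i. \<exists>k<i. ds ! k = (ds ! j \<^bold>\<rightarrow> ds ! i)))"

definition derives :: "logic \<Rightarrow> 'v fm set \<Rightarrow> 'v fm \<Rightarrow> bool" where
  "derives L \<Gamma> \<phi> \<longleftrightarrow> (\<exists>ds. ds \<noteq> [] \<and> derivation L \<Gamma> ds \<and> last ds = \<phi>)"


section \<open>Multialgebras and valuations\<close>

text \<open>Only the values of the multioperations on arguments in the universe matter.\<close>

record 'a multialgebra =
  Univ :: "'a set"
  orM :: "'a \<Rightarrow> 'a \<Rightarrow> 'a set"
  andM :: "'a \<Rightarrow> 'a \<Rightarrow> 'a set"
  impM :: "'a \<Rightarrow> 'a \<Rightarrow> 'a set"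
  incM :: "'a \<Rightarrow> 'a \<Rightarrow> 'a set"
  negM :: "'a \<Rightarrow> 'a set"

definition multiop2_on :: "'a set \<Rightarrow> ('a \<Rightarrow> 'a \<Rightarrow> 'a set) \<Rightarrow> bool" where
  "multiop2_on A f \<longleftrightarrow> (\<forall>a\<in>A. \<forall>b\<in>A. f a b \<noteq> {} \<and> f a b \<subseteq> A)"

definition multialgebra :: "'a multialgebra \<Rightarrow> bool" where
  "multialgebra M \<longleftrightarrow>
     Univ M \<noteq> {} \<and>
     multiop2_on (Univ M) (orM M) \<and> multiop2_on (Univ M) (andM M) \<and>
     multiop2_on (Univ M) (impM M) \<and> multiop2_on (Univ M) (incM M) \<and>
     (\<forall>a\<in>Univ M. negM M a \<noteq> {} \<and> negM M a \<subseteq> Univ M)"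

definition valuation :: "'a multialgebra \<Rightarrow> ('v fm \<Rightarrow> 'a) \<Rightarrow> bool" where
  "valuation M \<nu> \<longleftrightarrow>
     (\<forall>\<phi>. \<nu> \<phi> \<in> Univ M) \<and>
     (\<forall>\<phi> \<psi>. \<nu> (\<phi> \<^bold>\<or> \<psi>) \<in> orM M (\<nu> \<phi>) (\<nu> \<psi>)) \<and>
     (\<forall>\<phi> \<psi>. \<nu> (\<phi> \<^bold>\<and> \<psi>) \<in> andM M (\<nu> \<phi>) (\<nu> \<psi>)) \<and>
     (\<forall>\<phi> \<psi>. \<nu> (\<phi> \<^bold>\<rightarrow> \<psi>) \<in> impM M (\<nu> \<phi>) (\<nu> \<psi>)) \<and>
     (\<forall>\<phi> \<psi>. \<nu> (\<phi> \<^bold>\<up> \<psi>) \<in> incM M (\<nu> \<phi>) (\<nu> \<psi>)) \<and>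
     (\<forall>\<phi>. \<nu> (\<^bold>\<not> \<phi>) \<in> negM M (\<nu> \<phi>))"


section \<open>Boolean algebras on a carrier set\<close>

text \<open>The axioms are those of \<^locale>\<open>abstract_boolean_algebra\<close>, relativised to the set
  \<open>A\<close>. The complement is not primitive: it is \<open>imp a zero\<close>.\<close>

locale boolean_algebra_on =
  fixes A :: "'a set"
    and meet join imp :: "'a \<Rightarrow> 'a \<Rightarrow> 'a"
    and zero one :: 'a
  assumes zero_closed: "zero \<in> A"
    and one_closed: "one \<in> A"
    and meet_closed: "\<lbrakk>a \<in> A; b \<in> A\<rbrakk> \<Longrightarrow> meet a b \<in> A"
    and join_closed: "\<lbrakk>a \<in> A; b \<in> A\<rbrakk> \<Longrightarrow> join a b \<in> A"
    and imp_closed: "\<lbrakk>a \<in> A; b \<in> A\<rbrakk> \<Longrightarrow> imp a b \<in> A"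
    and meet_assoc: "\<lbrakk>a \<in> A; b \<in> A; c \<in> A\<rbrakk> \<Longrightarrow> meet (meet a b) c = meet a (meet b c)"
    and join_assoc: "\<lbrakk>a \<in> A; b \<in> A; c \<in> A\<rbrakk> \<Longrightarrow> join (join a b) c = join a (join b c)"
    and meet_comm: "\<lbrakk>a \<in> A; b \<in> A\<rbrakk> \<Longrightarrow> meet a b = meet b a"
    and join_comm: "\<lbrakk>a \<in> A; b \<in> A\<rbrakk> \<Longrightarrow> join a b = join b a"
    and meet_join_distrib:
      "\<lbrakk>a \<in> A; b \<in> A; c \<in> A\<rbrakk> \<Longrightarrow> meet a (join b c) = join (meet a b) (meet a c)"
    and join_meet_distrib:
      "\<lbrakk>a \<in> A; b \<in> A; c \<in> A\<rbrakk> \<Longrightarrow> join a (meet b c) = meet (join a b) (join a c)"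
    and meet_one: "a \<in> A \<Longrightarrow> meet a one = a"
    and join_zero: "a \<in> A \<Longrightarrow> join a zero = a"
    and meet_compl: "a \<in> A \<Longrightarrow> meet a (imp a zero) = zero"
    and join_compl: "a \<in> A \<Longrightarrow> join a (imp a zero) = one"
    and imp_eq: "\<lbrakk>a \<in> A; b \<in> A\<rbrakk> \<Longrightarrow> imp a b = join (imp a zero) b"


section \<open>RNmatrices and their consequence relation\<close>

text \<open>In the condition for \<open>nbIci\<close>, negation is applied to the set \<open>incM M a b\<close>, so it
  denotes the union of the values \<open>negM M c\<close> over the elements \<open>c\<close> of that set.\<close>

locale rn_algebra =
  boolean_algebra_on "Univ M" meet join imp zero one
  for L :: logic and M :: "'a multialgebra"
    and meet join imp :: "'a \<Rightarrow> 'a \<Rightarrow> 'a" and zero one :: 'a +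
  assumes multialgebra: "multialgebra M"
    and andM_eq: "\<lbrakk>a \<in> Univ M; b \<in> Univ M\<rbrakk> \<Longrightarrow> andM M a b = {meet a b}"
    and orM_eq: "\<lbrakk>a \<in> Univ M; b \<in> Univ M\<rbrakk> \<Longrightarrow> orM M a b = {join a b}"
    and impM_eq: "\<lbrakk>a \<in> Univ M; b \<in> Univ M\<rbrakk> \<Longrightarrow> impM M a b = {imp a b}"
    and zero_neq_one: "zero \<noteq> one"
    and incM_comm: "\<lbrakk>a \<in> Univ M; b \<in> Univ M\<rbrakk> \<Longrightarrow> incM M a b = incM M b a"
    and incM_disjoint:
      "\<lbrakk>a \<in> Univ M; b \<in> Univ M; c \<in> incM M a b\<rbrakk> \<Longrightarrow> meet (meet a b) c = zero"
    and negM_cover: "\<lbrakk>a \<in> Univ M; b \<in> negM M a\<rbrakk> \<Longrightarrow> join a b = one"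
    and negM_incM:
      "\<lbrakk>a \<in> Univ M; b \<in> negM M a\<rbrakk> \<Longrightarrow> imp (meet a b) zero \<in> incM M a b"
    and ci:
      "\<lbrakk>L = nbIci; a \<in> Univ M; b \<in> negM M a\<rbrakk> \<Longrightarrow> meet a b \<in> (\<Union>c\<in>incM M a b. negM M c)"
    and cl:
      "\<lbrakk>L = nbIcl; a \<in> Univ M; b \<in> negM M a\<rbrakk> \<Longrightarrow> imp (meet a b) zero \<in> negM M (meet a b)"

definition restricted_valuations ::
  "logic \<Rightarrow> 'a multialgebra \<Rightarrow> ('a \<Rightarrow> 'a \<Rightarrow> 'a) \<Rightarrow> ('a \<Rightarrow> 'a \<Rightarrow> 'a) \<Rightarrow> 'a \<Rightarrow> ('v fm \<Rightarrow> 'a) set" where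
  "restricted_valuations L M meet imp zero =
     {\<nu>. valuation M \<nu> \<and>
         (\<forall>\<alpha> \<beta>. \<nu> (\<alpha> \<^bold>\<up> \<beta>) = \<nu> (\<beta> \<^bold>\<up> \<alpha>)) \<and>
         (\<forall>\<alpha>. \<nu> (\<alpha> \<^bold>\<up> \<^bold>\<not> \<alpha>) = imp (meet (\<nu> \<alpha>) (\<nu> (\<^bold>\<not> \<alpha>))) zero) \<and>
         (L = nbIci \<longrightarrow> (\<forall>\<alpha>. \<nu> (\<^bold>\<not> (\<alpha> \<^bold>\<up> \<^bold>\<not> \<alpha>)) = meet (\<nu> \<alpha>) (\<nu> (\<^bold>\<not> \<alpha>)))) \<and>
         (L = nbIcl \<longrightarrow> (\<forall>\<alpha>. \<nu> (\<alpha> \<^bold>\<up> \<^bold>\<not> \<alpha>) = \<nu> (\<^bold>\<not> (\<alpha> \<^bold>\<and> \<^bold>\<not> \<alpha>))))}"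

definition rnmatrix ::
  "logic \<Rightarrow> 'a multialgebra \<Rightarrow> 'a set \<Rightarrow> ('v fm \<Rightarrow> 'a) set \<Rightarrow> bool" where
  "rnmatrix L M D F \<longleftrightarrow>
     (\<exists>meet join imp zero one.
        rn_algebra L M meet join imp zero one \<and>
        D = {one} \<and>
        F = restricted_valuations L M meet imp zero)"

text \<open>Universes of RNmatrices are arbitrary subsets of the type \<open>'a\<close>, which is carried by
  the \<open>itself\<close> argument since HOL cannot quantify over types inside a formula. For an
  infinite \<open>'a\<close> this is no restriction: given a countermodel of any cardinality, the range of
  its valuation (which is countable) together with the values witnessing nonemptiness of the
  multioperations and the \<open>nbIci\<close> condition generates a countable countermodel, and a countable
  universe embeds into \<open>'a\<close>.\<close>

definition entails :: "'a itself \<Rightarrow> logic \<Rightarrow> 'v fm set \<Rightarrow> 'v fm \<Rightarrow> bool" where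
  "entails (_ :: 'a itself) L \<Gamma> \<phi> \<longleftrightarrow>
     (\<forall>(M :: 'a multialgebra) D F. rnmatrix L M D F \<longrightarrow>
        (\<forall>\<nu>\<in>F. (\<forall>\<gamma>\<in>\<Gamma>. \<nu> \<gamma> \<in> D) \<longrightarrow> \<nu> \<phi> \<in> D))"

end

theory Submission
  imports Defs
begin

text \<open>The proof is by contraposition, and the two-element Boolean algebra suffices. If \<open>\<phi>\<close> is
  not derivable from \<open>\<Gamma>\<close>, Zorn's lemma extends \<open>\<Gamma>\<close> to a set \<open>\<Delta>\<close> that is maximal among the sets
  not deriving \<open>\<phi>\<close> (\<open>ex_saturated_extension\<close>). By the deduction theorem, \<open>\<Delta>\<close> is closed under
  derivation and prime, and the classical axioms force membership in \<open>\<Delta>\<close> to follow the truth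
  tables of \<open>\<and>\<close>, \<open>\<or>\<close> and \<open>\<rightarrow>\<close>.

  The universe \<open>{zero, one}\<close> carries a largest multialgebra compatible with
  \<open>\<alpha> \<or> \<not> \<alpha>\<close> and \<open>(\<alpha> \<up> \<beta>) \<rightarrow> (\<alpha> \<rightarrow> (\<beta> \<rightarrow> \<gamma>))\<close>: negation is unconstrained except that it sends
  \<open>zero\<close> to \<open>one\<close>, and incompatibility is unconstrained except that it sends \<open>one, one\<close> to
  \<open>zero\<close>. This one structure satisfies the conditions on an RNmatrix for all three logics at once
  (\<open>rn_algebra_two_valued\<close>), so the logics differ only in the restrictions on valuations. The
  characteristic function of \<open>\<Delta>\<close> meets these restrictions because each of the three extra axioms
  makes exactly one of \<open>\<alpha> \<up> \<not> \<alpha>\<close> and \<open>\<alpha> \<and> \<not> \<alpha>\<close> belong to \<open>\<Delta>\<close> (\<open>saturated_Inc_Neg\<close>). It designates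
  exactly the members of \<open>\<Delta>\<close>, hence all of \<open>\<Gamma>\<close> but not \<open>\<phi>\<close>.\<close>

section \<open>Derivability as an inductive closure\<close>

text \<open>Derivations are lists, which makes induction over them awkward; the least set containing
  axioms and premises and closed under Modus Ponens has a usable induction rule.\<close>

inductive deduces :: "logic \<Rightarrow> 'v fm set \<Rightarrow> 'v fm \<Rightarrow> bool" for L \<Gamma> where
  axiom: "is_axiom L \<phi> \<Longrightarrow> deduces L \<Gamma> \<phi>"
| premise: "\<phi> \<in> \<Gamma> \<Longrightarrow> deduces L \<Gamma> \<phi>"
| mp: "deduces L \<Gamma> (\<phi> \<^bold>\<rightarrow> \<psi>) \<Longrightarrow> deduces L \<Gamma> \<phi> \<Longrightarrow> deduces L \<Gamma> \<psi>"

lemma derivation_append: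
  assumes "derivation L \<Gamma> ds" "derivation L \<Gamma> es"
  shows "derivation L \<Gamma> (ds @ es)"
  unfolding derivation_def
proof (intro allI impI)
  fix i assume i: "i < length (ds @ es)"
  show "is_axiom L ((ds @ es) ! i) \<or> (ds @ es) ! i \<in> \<Gamma> \<or>
    (\<exists>j<i. \<exists>k<i. (ds @ es) ! k = ((ds @ es) ! j \<^bold>\<rightarrow> (ds @ es) ! i))"
  proof (cases "i < length ds")
    case True
    with assms(1) consider "is_axiom L (ds ! i)" | "ds ! i \<in> \<Gamma>"
      | j k where "j < i" "k < i" "ds ! k = (ds ! j \<^bold>\<rightarrow> ds ! i)"
      unfolding derivation_def by blast
    then show ?thesis
    proof cases
      case 3
      with True have "(ds @ es) ! k = ((ds @ es) ! j \<^bold>\<rightarrow> (ds @ es) ! i)"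
        by (simp add: nth_append)
      with 3 show ?thesis by blast
    qed (use True in \<open>simp_all add: nth_append\<close>)
  next
    case False
    define m where "m = i - length ds"
    have i_eq: "i = length ds + m" and "m < length es"
      using False i by (auto simp: m_def)
    with assms(2) consider "is_axiom L (es ! m)" | "es ! m \<in> \<Gamma>"
      | j k where "j < m" "k < m" "es ! k = (es ! j \<^bold>\<rightarrow> es ! m)"
      unfolding derivation_def by blast
    then show ?thesis
    proof cases
      case 3
      then have "(ds @ es) ! (length ds + k) = ((ds @ es) ! (length ds + j) \<^bold>\<rightarrow> (ds @ es) ! i)"
        by (simp add: i_eq)
      moreover have "length ds + k < i" "length ds + j < i"
        using 3 by (auto simp: i_eq)
      ultimately show ?thesis by blast
    qed (simp_all add: i_eq)
  qed
qed

lemma derivation_snoc: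
  assumes "derivation L \<Gamma> ds"
    and "is_axiom L \<phi> \<or> \<phi> \<in> \<Gamma> \<or> (\<exists>\<psi>\<in>set ds. (\<psi> \<^bold>\<rightarrow> \<phi>) \<in> set ds)"
  shows "derivation L \<Gamma> (ds @ [\<phi>])"
  unfolding derivation_def
proof (intro allI impI)
  fix i assume "i < length (ds @ [\<phi>])"
  then consider "i < length ds" | "i = length ds" by fastforce
  then show "is_axiom L ((ds @ [\<phi>]) ! i) \<or> (ds @ [\<phi>]) ! i \<in> \<Gamma> \<or>
    (\<exists>j<i. \<exists>k<i. (ds @ [\<phi>]) ! k = ((ds @ [\<phi>]) ! j \<^bold>\<rightarrow> (ds @ [\<phi>]) ! i))"
  proof cases
    case 1
    with assms(1) consider "is_axiom L (ds ! i)" | "ds ! i \<in> \<Gamma>"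
      | j k where "j < i" "k < i" "ds ! k = (ds ! j \<^bold>\<rightarrow> ds ! i)"
      unfolding derivation_def by blast
    then show ?thesis
    proof cases
      case 3
      with 1 have "(ds @ [\<phi>]) ! k = ((ds @ [\<phi>]) ! j \<^bold>\<rightarrow> (ds @ [\<phi>]) ! i)"
        by (simp add: nth_append)
      with 3 show ?thesis by blast
    qed (use 1 in \<open>simp_all add: nth_append\<close>)
  next
    case 2
    from assms(2) consider "is_axiom L \<phi>" | "\<phi> \<in> \<Gamma>"
      | j k where "j < length ds" "k < length ds" "ds ! k = (ds ! j \<^bold>\<rightarrow> \<phi>)"
      by (metis in_set_conv_nth)
    then show ?thesis
    proof cases
      case 3
      with 2 have "(ds @ [\<phi>]) ! k = ((ds @ [\<phi>]) ! j \<^bold>\<rightarrow> (ds @ [\<phi>]) ! i)"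
        by (simp add: nth_append)
      with 2 3 show ?thesis by blast
    qed (use 2 in simp_all)
  qed
qed

lemma derives_if_deduces: "deduces L \<Gamma> \<phi> \<Longrightarrow> derives L \<Gamma> \<phi>"
proof (induction rule: deduces.induct)
  case (axiom \<phi>)
  then have "derivation L \<Gamma> [\<phi>]" by (simp add: derivation_def)
  then show ?case unfolding derives_def by (intro exI[of _ "[\<phi>]"]) simp
next
  case (premise \<phi>)
  then have "derivation L \<Gamma> [\<phi>]" by (simp add: derivation_def)
  then show ?case unfolding derives_def by (intro exI[of _ "[\<phi>]"]) simp
next
  case (mp \<phi> \<psi>)
  then obtain ds es where ds: "ds \<noteq> []" "derivation L \<Gamma> ds" "last ds = (\<phi> \<^bold>\<rightarrow> \<psi>)"
    and es: "es \<noteq> []" "derivation L \<Gamma> es" "last es = \<phi>"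
    unfolding derives_def by blast
  have "(\<phi> \<^bold>\<rightarrow> \<psi>) \<in> set (ds @ es)" "\<phi> \<in> set (ds @ es)"
    using ds es last_in_set by fastforce+
  then have "derivation L \<Gamma> ((ds @ es) @ [\<psi>])"
    using derivation_snoc derivation_append ds es by blast
  then show ?case unfolding derives_def
    by (intro exI[of _ "(ds @ es) @ [\<psi>]"]) simp
qed

section \<open>Deduction theorem and compactness\<close>

lemma deduces_mono: "deduces L \<Gamma> \<phi> \<Longrightarrow> \<Gamma> \<subseteq> \<Delta> \<Longrightarrow> deduces L \<Delta> \<phi>"
  by (induction rule: deduces.induct) (auto intro: deduces.intros)

lemma deduces_finite_subset:
  "deduces L \<Gamma> \<phi> \<Longrightarrow> \<exists>\<Gamma>0\<subseteq>\<Gamma>. finite \<Gamma>0 \<and> deduces L \<Gamma>0 \<phi>"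
proof (induction rule: deduces.induct)
  case (axiom \<phi>)
  then show ?case by (intro exI[of _ "{}"]) (simp add: deduces.axiom)
next
  case (premise \<phi>)
  then show ?case by (intro exI[of _ "{\<phi>}"]) (simp add: deduces.premise)
next
  case (mp \<phi> \<psi>)
  then obtain A B where "A \<subseteq> \<Gamma>" "finite A" "deduces L A (\<phi> \<^bold>\<rightarrow> \<psi>)"
    and "B \<subseteq> \<Gamma>" "finite B" "deduces L B \<phi>" by blast
  then show ?case
    by (intro exI[of _ "A \<union> B"]) (auto intro: deduces.mp[of _ _ \<phi>] elim: deduces_mono)
qed

lemma axiom_nbI_deduces: "axiom_nbI \<phi> \<Longrightarrow> deduces L \<Gamma> \<phi>"
  by (simp add: deduces.axiom is_axiom_def)

lemma deduction_theorem:
  assumes "deduces L (insert \<psi> \<Gamma>) \<phi>"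
  shows "deduces L \<Gamma> (\<psi> \<^bold>\<rightarrow> \<phi>)"
proof -
  have weaken: "deduces L \<Gamma> (\<psi> \<^bold>\<rightarrow> \<chi>)" if "deduces L \<Gamma> \<chi>" for \<chi>
    using deduces.mp[OF axiom_nbI_deduces[OF axiom_nbI.intros(1)] that] .
  have distrib: "deduces L \<Gamma> (\<psi> \<^bold>\<rightarrow> \<chi>')"
    if "deduces L \<Gamma> (\<psi> \<^bold>\<rightarrow> (\<chi> \<^bold>\<rightarrow> \<chi>'))" "deduces L \<Gamma> (\<psi> \<^bold>\<rightarrow> \<chi>)" for \<chi> \<chi>'
    using deduces.mp[OF deduces.mp[OF axiom_nbI_deduces[OF axiom_nbI.intros(2)] that(1)] that(2)] .
  have self: "deduces L \<Gamma> (\<psi> \<^bold>\<rightarrow> \<psi>)"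
    using distrib[OF axiom_nbI_deduces[OF axiom_nbI.intros(1)[of \<psi> "\<psi> \<^bold>\<rightarrow> \<psi>"]]
        axiom_nbI_deduces[OF axiom_nbI.intros(1)]] .
  from assms show ?thesis
  proof (induction rule: deduces.induct)
    case (axiom \<chi>)
    then show ?case by (simp add: weaken deduces.axiom)
  next
    case (premise \<chi>)
    then show ?case using self by (auto intro: weaken deduces.premise)
  next
    case (mp \<chi> \<chi>')
    then show ?case using distrib by blast
  qed
qed

section \<open>Saturated sets\<close>

definition saturated :: "logic \<Rightarrow> 'v fm \<Rightarrow> 'v fm set \<Rightarrow> bool" where
  "saturated L \<phi> \<Delta> \<longleftrightarrow>
     \<not> deduces L \<Delta> \<phi> \<and> (\<forall>\<psi>. \<psi> \<notin> \<Delta> \<longrightarrow> deduces L (insert \<psi> \<Delta>) \<phi>)"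

text \<open>By compactness, the union of a chain of sets not deriving \<open>\<phi>\<close> does not derive it
  either, so Zorn's lemma applies.\<close>

lemma ex_saturated_extension:
  assumes "\<not> deduces L \<Gamma> \<phi>"
  obtains \<Delta> where "\<Gamma> \<subseteq> \<Delta>" "saturated L \<phi> \<Delta>"
proof -
  let ?S = "{\<Delta>. \<Gamma> \<subseteq> \<Delta> \<and> \<not> deduces L \<Delta> \<phi>}"
  have "\<Union>C \<in> ?S" if C: "C \<noteq> {}" "subset.chain ?S C" for C
  proof -
    have "\<not> deduces L (\<Union>C) \<phi>"
    proof
      assume "deduces L (\<Union>C) \<phi>"
      then obtain F where F: "F \<subseteq> \<Union>C" "finite F" "deduces L F \<phi>"
        using deduces_finite_subset by blast
      then obtain B where "B \<in> C" "F \<subseteq> B"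
        using finite_subset_Union_chain[OF F(2,1) C] by blast
      moreover have "B \<in> ?S" using C(2) \<open>B \<in> C\<close> by (auto simp: subset.chain_def)
      ultimately show False using F(3) deduces_mono by blast
    qed
    moreover have "\<Gamma> \<subseteq> \<Union>C" using C unfolding subset.chain_def by blast
    ultimately show ?thesis by simp
  qed
  moreover have "?S \<noteq> {}" using assms by blast
  ultimately obtain \<Delta> where \<Delta>: "\<Delta> \<in> ?S" "\<forall>X\<in>?S. \<Delta> \<subseteq> X \<longrightarrow> X = \<Delta>"
    using subset_Zorn_nonempty[of ?S] by blast
  have "deduces L (insert \<psi> \<Delta>) \<phi>" if "\<psi> \<notin> \<Delta>" for \<psi>
    using \<Delta> that by blast
  with \<Delta>(1) have "saturated L \<phi> \<Delta>" by (simp add: saturated_def)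
  with \<Delta>(1) show thesis using that by blast
qed

context
  fixes L :: logic and \<phi> :: "'v fm" and \<Delta> :: "'v fm set"
  assumes sat: "saturated L \<phi> \<Delta>"
begin

lemma saturated_not_mem: "\<phi> \<notin> \<Delta>"
  using sat by (auto simp: saturated_def intro: deduces.premise)

lemma saturated_Imp_goal: "\<psi> \<notin> \<Delta> \<Longrightarrow> deduces L \<Delta> (\<psi> \<^bold>\<rightarrow> \<phi>)"
  using sat by (simp add: saturated_def deduction_theorem)

lemma saturated_closed: "deduces L \<Delta> \<psi> \<Longrightarrow> \<psi> \<in> \<Delta>"
  using sat saturated_Imp_goal deduces.mp unfolding saturated_def by blast

lemma saturated_axiom: "axiom_nbI \<psi> \<Longrightarrow> \<psi> \<in> \<Delta>"
  by (simp add: saturated_closed axiom_nbI_deduces)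

lemma saturated_mp: "(\<alpha> \<^bold>\<rightarrow> \<beta>) \<in> \<Delta> \<Longrightarrow> \<alpha> \<in> \<Delta> \<Longrightarrow> \<beta> \<in> \<Delta>"
  by (meson saturated_closed deduces.mp deduces.premise)

text \<open>If neither disjunct belongs to \<open>\<Delta>\<close>, then each implies \<open>\<phi>\<close>, and so does the disjunction.\<close>

lemma saturated_Or: "(\<alpha> \<^bold>\<or> \<beta>) \<in> \<Delta> \<longleftrightarrow> \<alpha> \<in> \<Delta> \<or> \<beta> \<in> \<Delta>"
proof
  assume or: "(\<alpha> \<^bold>\<or> \<beta>) \<in> \<Delta>"
  show "\<alpha> \<in> \<Delta> \<or> \<beta> \<in> \<Delta>"
  proof (rule ccontr)
    assume "\<not> (\<alpha> \<in> \<Delta> \<or> \<beta> \<in> \<Delta>)"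
    then have "(\<alpha> \<^bold>\<rightarrow> \<phi>) \<in> \<Delta>" "(\<beta> \<^bold>\<rightarrow> \<phi>) \<in> \<Delta>"
      by (simp_all add: saturated_closed saturated_Imp_goal)
    then show False
      using saturated_axiom[OF axiom_nbI.intros(8)] saturated_mp or saturated_not_mem by blast
  qed
qed (use saturated_mp saturated_axiom axiom_nbI.intros(6,7) in blast)

lemma saturated_And: "(\<alpha> \<^bold>\<and> \<beta>) \<in> \<Delta> \<longleftrightarrow> \<alpha> \<in> \<Delta> \<and> \<beta> \<in> \<Delta>"
  by (meson saturated_mp saturated_axiom axiom_nbI.intros(3-5))

text \<open>The axiom \<open>(\<alpha> \<rightarrow> \<beta>) \<or> \<alpha>\<close> makes implication classical: by primeness, an absent antecedent
  yields the implication.\<close>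

lemma saturated_Imp: "(\<alpha> \<^bold>\<rightarrow> \<beta>) \<in> \<Delta> \<longleftrightarrow> (\<alpha> \<in> \<Delta> \<longrightarrow> \<beta> \<in> \<Delta>)"
  using saturated_mp saturated_axiom[OF axiom_nbI.intros(1)]
    saturated_axiom[OF axiom_nbI.intros(9), of \<alpha> \<beta>] saturated_Or by blast

lemma saturated_Neg: "\<alpha> \<notin> \<Delta> \<Longrightarrow> (\<^bold>\<not> \<alpha>) \<in> \<Delta>"
  using saturated_axiom[OF axiom_nbI.intros(12), of \<alpha>] saturated_Or by blast

text \<open>Otherwise axiom \<open>Ip\<close> would put \<open>\<phi>\<close> into \<open>\<Delta>\<close>.\<close>

lemma saturated_Inc: "(\<alpha> \<^bold>\<up> \<beta>) \<in> \<Delta> \<Longrightarrow> \<not> (\<alpha> \<in> \<Delta> \<and> \<beta> \<in> \<Delta>)"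
  using saturated_mp saturated_axiom[OF axiom_nbI.Ip, of \<alpha> \<beta> \<phi>] saturated_not_mem by blast

lemma saturated_Inc_commute: "(\<alpha> \<^bold>\<up> \<beta>) \<in> \<Delta> \<longleftrightarrow> (\<beta> \<^bold>\<up> \<alpha>) \<in> \<Delta>"
  using saturated_mp saturated_axiom[OF axiom_nbI.Comm] by blast

lemma saturated_extra_axiom: "extra_axiom L \<alpha> \<in> \<Delta>"
  by (rule saturated_closed, rule deduces.axiom) (auto simp: is_axiom_def)

text \<open>The axiom for \<open>nbIciw\<close> states the missing half of this equivalence outright. It holds for
  the other two logics by excluded middle, applied to \<open>\<alpha> \<up> \<not> \<alpha>\<close> for \<open>nbIci\<close> and to
  \<open>\<alpha> \<and> \<not> \<alpha>\<close> for \<open>nbIcl\<close>.\<close>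

lemma saturated_Inc_Neg: "(\<alpha> \<^bold>\<up> \<^bold>\<not> \<alpha>) \<in> \<Delta> \<longleftrightarrow> \<not> (\<alpha> \<in> \<Delta> \<and> (\<^bold>\<not> \<alpha>) \<in> \<Delta>)"
proof -
  have "(\<alpha> \<^bold>\<up> \<^bold>\<not> \<alpha>) \<in> \<Delta> \<or> (\<alpha> \<^bold>\<and> \<^bold>\<not> \<alpha>) \<in> \<Delta>"
    using saturated_extra_axiom[of \<alpha>] saturated_Neg[of "\<alpha> \<^bold>\<up> \<^bold>\<not> \<alpha>"]
      saturated_Neg[of "\<alpha> \<^bold>\<and> \<^bold>\<not> \<alpha>"]
    by (cases L) (auto simp: saturated_Or saturated_Imp)
  then show ?thesis using saturated_Inc saturated_And by blast
qed

lemma saturated_ci: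
  assumes "L = nbIci"
  shows "(\<^bold>\<not> (\<alpha> \<^bold>\<up> \<^bold>\<not> \<alpha>)) \<in> \<Delta> \<longleftrightarrow> \<alpha> \<in> \<Delta> \<and> (\<^bold>\<not> \<alpha>) \<in> \<Delta>"
proof -
  have "(\<^bold>\<not> (\<alpha> \<^bold>\<up> \<^bold>\<not> \<alpha>) \<^bold>\<rightarrow> (\<alpha> \<^bold>\<and> \<^bold>\<not> \<alpha>)) \<in> \<Delta>"
    using saturated_extra_axiom[of \<alpha>] unfolding assms extra_axiom.simps .
  then show ?thesis
    using saturated_mp saturated_And saturated_Neg saturated_Inc_Neg by blast
qed

lemma saturated_cl:
  assumes "L = nbIcl"
  shows "(\<alpha> \<^bold>\<up> \<^bold>\<not> \<alpha>) \<in> \<Delta> \<longleftrightarrow> (\<^bold>\<not> (\<alpha> \<^bold>\<and> \<^bold>\<not> \<alpha>)) \<in> \<Delta>"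
proof -
  have "(\<^bold>\<not> (\<alpha> \<^bold>\<and> \<^bold>\<not> \<alpha>) \<^bold>\<rightarrow> (\<alpha> \<^bold>\<up> \<^bold>\<not> \<alpha>)) \<in> \<Delta>"
    using saturated_extra_axiom[of \<alpha>] unfolding assms extra_axiom.simps .
  then show ?thesis
    using saturated_mp saturated_And saturated_Neg saturated_Inc_Neg by blast
qed

end

section \<open>The two-valued RNmatrix\<close>

definition two_valued :: "'a \<Rightarrow> 'a \<Rightarrow> 'a multialgebra" where
  "two_valued zero one =
     \<lparr>Univ = {zero, one},
      orM = (\<lambda>a b. {if a = one \<or> b = one then one else zero}),
      andM = (\<lambda>a b. {if a = one \<and> b = one then one else zero}),
      impM = (\<lambda>a b. {if a = one \<longrightarrow> b = one then one else zero}),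
      incM = (\<lambda>a b. if a = one \<and> b = one then {zero} else {zero, one}),
      negM = (\<lambda>a. if a = one then {zero, one} else {one})\<rparr>"

text \<open>The condition for \<open>nbIci\<close> is the only one needing a choice: when \<open>a\<close> and \<open>b\<close> are both
  \<open>one\<close>, the value \<open>zero\<close> of \<open>a \<up> b\<close> has negation \<open>one\<close>; otherwise \<open>one\<close> is a possible value of
  \<open>a \<up> b\<close>, and its negation may be \<open>zero\<close>.\<close>

lemma rn_algebra_two_valued:
  assumes "zero \<noteq> one"
  shows "rn_algebra L (two_valued zero one)
     (\<lambda>a b. if a = one \<and> b = one then one else zero)
     (\<lambda>a b. if a = one \<or> b = one then one else zero)
     (\<lambda>a b. if a = one \<longrightarrow> b = one then one else zero) zero one"
  using assms
  by unfold_locales (simp_all add: two_valued_def multialgebra_def multiop2_on_def, auto)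

lemma saturated_restricted_valuation:
  assumes "saturated L \<phi> \<Delta>" and "zero \<noteq> one"
  shows "(\<lambda>\<psi>. if \<psi> \<in> \<Delta> then one else zero) \<in> restricted_valuations L (two_valued zero one)
     (\<lambda>a b. if a = one \<and> b = one then one else zero)
     (\<lambda>a b. if a = one \<longrightarrow> b = one then one else zero) zero"
proof -
  have "valuation (two_valued zero one) (\<lambda>\<psi>. if \<psi> \<in> \<Delta> then one else zero)"
  proof -
    have "\<not> (\<alpha> \<in> \<Delta> \<and> \<beta> \<in> \<Delta> \<and> (\<alpha> \<^bold>\<up> \<beta>) \<in> \<Delta>)" for \<alpha> \<beta>
      using saturated_Inc[OF assms(1)] by blast
    moreover have "\<alpha> \<in> \<Delta> \<or> (\<^bold>\<not> \<alpha>) \<in> \<Delta>" for \<alpha>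
      using saturated_Neg[OF assms(1)] by blast
    ultimately show ?thesis
      using assms(2) unfolding valuation_def two_valued_def
      by (simp add: saturated_Or[OF assms(1)] saturated_And[OF assms(1)]
          saturated_Imp[OF assms(1)]) metis
  qed
  moreover have "(\<alpha> \<^bold>\<up> \<beta>) \<in> \<Delta> \<longleftrightarrow> (\<beta> \<^bold>\<up> \<alpha>) \<in> \<Delta>" for \<alpha> \<beta>
    by (rule saturated_Inc_commute[OF assms(1)])
  ultimately show ?thesis
    using assms(2) saturated_ci[OF assms(1)] saturated_cl[OF assms(1), symmetric]
    unfolding restricted_valuations_def
    by (simp add: saturated_Inc_Neg[OF assms(1)])
qed

theorem theorem13:
  fixes L :: logic and \<Gamma> :: "('v::countable) fm set" and \<phi> :: "'v fm"
  assumes "entails TYPE('a::infinite) L \<Gamma> \<phi>"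
  shows "derives L \<Gamma> \<phi>"
proof (rule ccontr)
  assume "\<not> derives L \<Gamma> \<phi>"
  then obtain \<Delta> where "\<Gamma> \<subseteq> \<Delta>" and \<Delta>: "saturated L \<phi> \<Delta>"
    using derives_if_deduces ex_saturated_extension by metis
  obtain zero one :: 'a where ne: "zero \<noteq> one"
    using ex_new_if_finite[OF infinite_UNIV, of "{undefined :: 'a}"] by auto
  let ?\<nu> = "\<lambda>\<psi>. if \<psi> \<in> \<Delta> then one else zero"
  let ?F = "restricted_valuations L (two_valued zero one)
     (\<lambda>a b. if a = one \<and> b = one then one else zero)
     (\<lambda>a b. if a = one \<longrightarrow> b = one then one else zero) zero"
  have "rnmatrix L (two_valued zero one) {one} ?F"
    unfolding rnmatrix_def using rn_algebra_two_valued[OF ne] by blast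
  with assms have "\<forall>\<nu>\<in>?F. (\<forall>\<gamma>\<in>\<Gamma>. \<nu> \<gamma> \<in> {one}) \<longrightarrow> \<nu> \<phi> \<in> {one}"
    unfolding entails_def by blast
  from bspec[OF this saturated_restricted_valuation[OF \<Delta> ne]]
  have "?\<nu> \<phi> \<in> {one}" using \<open>\<Gamma> \<subseteq> \<Delta>\<close> by auto
  then show False using saturated_not_mem[OF \<Delta>] ne by simp
qed

end
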